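(* Let $p$ be an odd prime, let $n\ge 3$ be an integer, and let $m=n+7$. Then there exists a group $G$ of order $p^m$, exponent $p^n$ and with no non-trivial abelian direct factor such that $\operatorname{Aut}(G)=\operatorname{Autcent}(G)$ and this group is non-abelian.
   Context: $\operatorname{Aut}(G)$ is the group of all automorphisms of $G$. An automorphism $\alpha$ of $G$ is called central if $x^{-1}\alpha(x)\in Z(G)$ for all $x\in G$, where $Z(G)$ is the center of $G$; $\operatorname{Autcent}(G)$ denotes the group of all central automorphisms of $G$. *)

theory Defs
  imports
    "HOL-Algebra.Algebra"
    "HOL-Computational_Algebra.Primes"
begin

definition group_center :: "('a, 'b) monoid_scheme \<Rightarrow> 'a set" where
  "group_center G = {z \<in> carrier G. \<forall>x \<in> carrier G. z \<otimes>\<^bsub>G\<^esub> x = x \<otimes>\<^bsub>G\<^esub> z}"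

text \<open>
  The exponent is only meaningful when some positive \<open>e\<close> annihilates the group, as is the case
  for every finite group; otherwise the value of \<open>LEAST\<close> is unspecified.
\<close>

definition group_exponent :: "('a, 'b) monoid_scheme \<Rightarrow> nat" where
  "group_exponent G = (LEAST e. 0 < e \<and> (\<forall>x \<in> carrier G. x [^]\<^bsub>G\<^esub> e = \<one>\<^bsub>G\<^esub>))"

definition direct_factor :: "'a set \<Rightarrow> ('a, 'b) monoid_scheme \<Rightarrow> bool" where
  "direct_factor H G \<longleftrightarrow>
     H \<lhd> G \<and> (\<exists>K. K \<lhd> G \<and> H \<inter> K = {\<one>\<^bsub>G\<^esub>} \<and> H <#>\<^bsub>G\<^esub> K = carrier G)"

text \<open>
  The case \<open>H = carrier G\<close> is included, so a group without non-trivial abelian direct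
  factor is itself non-abelian or trivial.
\<close>

definition no_nontrivial_abelian_direct_factor :: "('a, 'b) monoid_scheme \<Rightarrow> bool" where
  "no_nontrivial_abelian_direct_factor G \<longleftrightarrow>
     (\<forall>H. direct_factor H G \<and> comm_group (G\<lparr>carrier := H\<rparr>) \<longrightarrow> H = {\<one>\<^bsub>G\<^esub>})"

definition autcent :: "('a, 'b) monoid_scheme \<Rightarrow> ('a \<Rightarrow> 'a) set" where
  "autcent G =
     {\<alpha> \<in> auto G. \<forall>x \<in> carrier G. inv\<^bsub>G\<^esub> x \<otimes>\<^bsub>G\<^esub> \<alpha> x \<in> group_center G}"

definition AutcentGroup :: "('a, 'b) monoid_scheme \<Rightarrow> ('a \<Rightarrow> 'a) monoid" where
  "AutcentGroup G = AutoGroup G \<lparr>carrier := autcent G\<rparr>"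

end

theory Submission
  imports Defs "HOL-Library.Countable" "HOL-Library.Product_Plus"
begin

text \<open>
  The group comes from a nilpotent Lie ring of class two. Let \<open>L\<close> be the abelian group
  \<open>\<int>/p\<^sup>n \<oplus> \<int>/p\<^sup>3 \<oplus> \<int>/p\<^sup>2 \<oplus> \<int>/p\<^sup>2\<close> with standard generators \<open>x1, x2, x3, x4\<close>, put
  \<open>w1 = p\<^bsup>n-1\<^esup> x1\<close>, \<open>w2 = p\<^sup>2 x2\<close>, \<open>w3 = p x3\<close>, \<open>w4 = p x4\<close>, and let the alternating bracket be
  
  \<open>[x1,x2] = w4\<close>, \<open>[x1,x3] = w3\<close>, \<open>[x1,x4] = 0\<close>, \<open>[x2,x3] = w4\<close>, \<open>[x2,x4] = w2\<close>, \<open>[x3,x4] = w1\<close>.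
  
  As the brackets lie in \<open>pL\<close> and have order \<open>p\<close>, the operation \<open>u v = u + v + [u,v]\<close> makes \<open>L\<close>
  into a group \<open>G\<close> of class two. This is the Baer correspondence in which the factor \<open>1/2\<close> is
  absorbed into the bracket: the \<open>k\<close>-th power of \<open>u\<close> is \<open>k u\<close>, and the commutator of \<open>u\<close> and
  \<open>v\<close> is \<open>2 [u,v]\<close>. Thus the order is \<open>p\<^bsup>n+7\<^esup>\<close>, the exponent is \<open>p\<^sup>n\<close>, and bracketing with
  \<open>x3\<close> and \<open>x4\<close> shows that the center is exactly \<open>pL\<close>.
  
  An abelian direct factor \<open>H\<close> is central, and all central elements are \<open>p\<close>-th powers; splitting a
  \<open>p\<close>-th root along the direct decomposition shows that each element of \<open>H\<close> is a \<open>p\<close>-th power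
  inside \<open>H\<close>, hence a \<open>p\<^sup>n\<close>-th power inside \<open>H\<close>, hence trivial
  (\<open>no_abelian_direct_factor_if_center_p_powers\<close>).
  
  An automorphism is central if and only if it acts trivially on \<open>L/pL\<close>. The images \<open>y1, y2, y3, y4\<close>
  of the generators satisfy the same bracket relations, since these are relations between commutators
  and powers and \<open>2\<close> is invertible (\<open>hom_bracket\<close>). Modulo \<open>p\<close> they become polynomial
  congruences for a \<open>4 \<times> 4\<close> matrix over the field with \<open>p\<close> elements, whose only solution with
  \<open>y3\<close> and \<open>y4\<close> not in the center is the identity matrix (\<open>mod_p_rigidity\<close>,
  \<open>images_congruent\<close>). The choice of brackets serves this purpose: two elements of order at
  most \<open>p\<^sup>2\<close> have a multiple of \<open>w1\<close> as their bracket; modulo \<open>w1\<close> and \<open>w2\<close>, bracketing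
  with \<open>x1\<close> and \<open>x2\<close> maps \<open>x3, x4\<close> to \<open>p x3, 0\<close> and \<open>p x4, 0\<close>, that is, acts as an
  idempotent and a nilpotent matrix, which an automorphism has to respect; and the brackets with values \<open>w1\<close> and \<open>w2\<close> together with \<open>[x1,x4] = 0\<close> and
  \<open>[x1,x2] = [x2,x3]\<close> remove the remaining freedom.
  
  There remain the automorphisms \<open>1 + f\<close> with \<open>f\<close> mapping \<open>L\<close> into the center and killing the
  brackets. Two of them are given by \<open>f(x1) = p x2\<close> and by \<open>g(x2) = p\<^bsup>n-2\<^esup> x1\<close>, with all other
  generators sent to \<open>0\<close>. They do not commute because \<open>g(f(x1)) = w1\<close> while \<open>f(g(x1)) = 0\<close>.
\<close>
(* Vectors are handled as single variables; coordinates appear only where they are asked for. *)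
declare split_paired_All [simp del] split_paired_Ex [simp del]

section \<open>Central direct factors\<close>

text \<open>
  Passing to a root inside the factor can be repeated forever, so all elements of the factor are
  infinitely \<open>q\<close>-divisible; a bounded exponent leaves only the identity.
\<close>
lemma (in group) no_abelian_direct_factor_if_center_p_powers:
  assumes roots: "\<And>z. z \<in> group_center G \<Longrightarrow> \<exists>t \<in> carrier G. z = t [^] (q::nat)"
    and exponent: "\<And>x. x \<in> carrier G \<Longrightarrow> x [^] (q ^ n) = \<one>"
  shows "no_nontrivial_abelian_direct_factor G"
  unfolding no_nontrivial_abelian_direct_factor_def
proof (intro allI impI)
  fix H assume "direct_factor H G \<and> comm_group (G\<lparr>carrier := H\<rparr>)"
  then obtain K where HG: "H \<lhd> G" and KG: "K \<lhd> G" and HK: "H \<inter> K = {\<one>}"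
    and HKG: "H <#> K = carrier G" and ab: "comm_group (G\<lparr>carrier := H\<rparr>)"
    unfolding direct_factor_def by auto
  interpret H: normal H G by fact
  interpret K: normal K G by fact
  \<comment> \<open>The commutator of \<open>h\<close> and \<open>k\<close> lies in both normal subgroups.\<close>
  have comm: "h \<otimes> k = k \<otimes> h" if h: "h \<in> H" and k: "k \<in> K" for h k
  proof -
    have hk: "h \<in> carrier G" "k \<in> carrier G" using h k by auto
    let ?c = "h \<otimes> k \<otimes> inv h \<otimes> inv k"
    have "k \<otimes> inv h \<otimes> inv k \<in> H"
      using H.inv_op_closed2[OF hk(2), of "inv h"] h by auto
    hence "?c \<in> H" using h hk by (simp add: m_assoc)
    moreover have "?c \<in> K"
      using K.inv_op_closed2[OF hk(1) k] k by auto
    ultimately have "?c = \<one>" using HK by auto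
    hence "h \<otimes> k \<otimes> inv h = k"
      using hk by (metis inv_equality inv_inv inv_closed m_closed)
    thus ?thesis using hk by (metis inv_solve_right m_closed)
  qed
  have dec: "\<exists>h\<in>H. \<exists>k\<in>K. x = h \<otimes> k" if "x \<in> carrier G" for x
    using that unfolding HKG[symmetric] set_mult_def by blast
  have abH: "h \<otimes> h' = h' \<otimes> h" if "h \<in> H" "h' \<in> H" for h h'
    using comm_groupE(4)[OF ab] that by simp
  have central: "H \<subseteq> group_center G"
  proof
    fix h assume h: "h \<in> H"
    have "h \<otimes> x = x \<otimes> h" if x: "x \<in> carrier G" for x
    proof -
      obtain h' k where *: "h' \<in> H" "k \<in> K" "x = h' \<otimes> k" using dec[OF x] by blast
      hence c: "h \<in> carrier G" "h' \<in> carrier G" "k \<in> carrier G" using h by auto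
      show ?thesis using abH[OF h *(1)] comm[OF h *(2)] c *(3) by (metis m_assoc)
    qed
    thus "h \<in> group_center G" using h by (auto simp: group_center_def)
  qed
  have root: "\<exists>h'\<in>H. h = h' [^] q" if h: "h \<in> H" for h
  proof -
    obtain t where t: "t \<in> carrier G" "h = t [^] q" using roots central h by blast
    obtain h' k where *: "h' \<in> H" "k \<in> K" "t = h' \<otimes> k" using dec[OF t(1)] by blast
    hence c: "h \<in> carrier G" "h' \<in> carrier G" "k \<in> carrier G" using h by auto
    \<comment> \<open>The \<open>K\<close>-component of \<open>h = t [^] q\<close> must vanish, as \<open>h\<close> lies in \<open>H\<close>.\<close>
    have eq: "h = h' [^] q \<otimes> k [^] q"
      using t(2) *(3) pow_mult_distrib[OF comm[OF *(1,2)] c(2,3)] by simp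
    have hq: "h' [^] q \<in> H" and kq: "k [^] q \<in> K"
      using H.subgroup_axioms K.subgroup_axioms *(1,2)
      by (metis subgroup_int_pow_closed int_pow_int)+
    have "inv (h' [^] q) \<otimes> h = k [^] q"
      using eq c by (simp add: inv_solve_left m_assoc[symmetric])
    moreover have "inv (h' [^] q) \<otimes> h \<in> H" using hq h by auto
    ultimately have "k [^] q = \<one>" using kq HK by auto
    thus ?thesis using eq *(1) c by auto
  qed
  have "\<exists>h'\<in>H. h = h' [^] (q ^ k)" if "h \<in> H" for h k
    using that
  proof (induction k arbitrary: h)
    case 0 thus ?case by (auto intro!: bexI[of _ h])
  next
    case (Suc k)
    obtain h' where h': "h' \<in> H" "h = h' [^] (q ^ k)" using Suc by blast
    obtain h'' where h'': "h'' \<in> H" "h' = h'' [^] q" using root h' by blast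
    have "h = h'' [^] (q ^ Suc k)" using h' h'' by (simp add: nat_pow_pow)
    thus ?case using h'' by blast
  qed
  hence "h = \<one>" if "h \<in> H" for h using exponent that by (metis H.mem_carrier)
  thus "H = {\<one>}" using H.one_closed by blast
qed


section \<open>Rigidity of the bracket relations modulo p\<close>

text \<open>
  The rows \<open>(ai, bi, ci, di)\<close> are the images of the four generators modulo \<open>P\<close>, and the hypothesis
  named after two indices comes from the bracket of the corresponding generators. The hypothesis
  \<open>z\<close> expresses that the last two images have order at most \<open>p\<^sup>2\<close>. The brackets of the generators 1, 2 and
  of 2, 3 both equal \<open>w4\<close>; their first two coordinates are compared in \<open>b1223\<close>.
  
  No scalar can be cancelled before it is known to be nonzero. The order below starts from
  \<open>c3\<close>, which cannot vanish because row 3 would vanish with it.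
\<close>
lemma mod_p_rigidity:
  fixes P :: int
  assumes P: "Factorial_Ring.prime P"
  and nz: "\<not> (P dvd c3 \<and> P dvd d3)" "\<not> (P dvd c4 \<and> P dvd d4)"
  and z: "P dvd a3" "P dvd b3" "P dvd a4" "P dvd b4"
  and b34: "P dvd c3 * d4 - d3 * c4 - a1"
  and b23: "P dvd a2 * c3 - c2 * a3 - c4" "P dvd a2 * b3 - b2 * a3 + b2 * c3 - c2 * b3 - d4"
  and b13: "P dvd a1 * c3 - c1 * a3 - c3" "P dvd a1 * b3 - b1 * a3 + b1 * c3 - c1 * b3 - d3"
  and b14: "P dvd c1 * d4 - d1 * c4" "P dvd b1 * d4 - d1 * b4" "P dvd a1 * c4 - c1 * a4"
  and b24: "P dvd b2 * d4 - d2 * b4 - b2"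
  and b12: "P dvd a1 * c2 - c1 * a2 - c4"
  and b1223: "P dvd (b1 * d2 - d1 * b2) - (b2 * d3 - d2 * b3)" "P dvd (c1 * d2 - d1 * c2) - (c2 * d3 - d2 * c3)"
  shows "P dvd a1 - 1 \<and> P dvd b1 \<and> P dvd c1 \<and> P dvd d1"
    and "P dvd a2 \<and> P dvd b2 - 1 \<and> P dvd c2 \<and> P dvd d2"
    and "P dvd c3 - 1 \<and> P dvd d3"
    and "P dvd c4 \<and> P dvd d4 - 1"
proof -
  note cancel = prime_dvd_multD[OF P]
  have c3: "\<not> P dvd c3"
  proof
    assume c3: "P dvd c3"
    hence "P dvd a1 * b3 - b1 * a3 + b1 * c3 - c1 * b3" using z by simp
    hence "P dvd d3" using dvd_diff[OF _ b13(2)] by fastforce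
    thus False using c3 nz by blast
  qed
  have "P dvd (a1 - 1) * c3"
    using dvd_add[OF b13(1) dvd_mult[OF z(1), of c1]] by (simp add: algebra_simps)
  hence a1: "P dvd a1 - 1" using c3 cancel by blast
  have c4: "P dvd c4"
    using dvd_diff[OF dvd_add[OF b14(3) dvd_mult[OF z(3), of c1]] dvd_mult[OF a1, of c4]]
    by (simp add: algebra_simps)
  hence d4: "\<not> P dvd d4" using nz by blast
  have "P dvd b1 * d4"
    using dvd_add[OF b14(2) dvd_mult[OF z(4), of d1]] by simp
  hence b1: "P dvd b1" using d4 cancel by blast
  have "P dvd c1 * d4"
    using dvd_add[OF b14(1) dvd_mult[OF c4, of d1]] by simp
  hence c1: "P dvd c1" using d4 cancel by blast
  have "P dvd a1 * b3 - b1 * a3 + b1 * c3 - c1 * b3" using z b1 by simp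
  hence d3: "P dvd d3" using dvd_diff[OF _ b13(2)] by fastforce
  have "P dvd a2 * c3"
    using dvd_add[OF dvd_add[OF b23(1) dvd_mult[OF z(1), of c2]] c4] by simp
  hence a2: "P dvd a2" using c3 cancel by blast
  have b2: "\<not> P dvd b2"
  proof
    assume "P dvd b2"
    hence "P dvd a2 * b3 - b2 * a3 + b2 * c3 - c2 * b3" using z by simp
    hence "P dvd d4" using dvd_diff[OF _ b23(2)] by fastforce
    thus False using d4 by blast
  qed
  have "P dvd b2 * (d4 - 1)"
    using dvd_add[OF b24 dvd_mult[OF z(4), of d2]] by (simp add: algebra_simps)
  hence d4': "P dvd d4 - 1" using b2 cancel by blast
  have "P dvd d3 * c4 + (a1 - 1) - c3 * (d4 - 1)" using c4 a1 d4' by simp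
  hence c3': "P dvd c3 - 1"
    using dvd_add[OF b34] by (fastforce simp: algebra_simps)
  have "P dvd b2 * a3 - a2 * b3 + c2 * b3 - b2 * (c3 - 1) + (d4 - 1)"
    using z c3' d4' by simp
  hence b2': "P dvd b2 - 1"
    using dvd_add[OF b23(2)] by (fastforce simp: algebra_simps)
  have "P dvd c1 * a2 + c4 - c2 * (a1 - 1)" using c1 c4 a1 by simp
  hence c2: "P dvd c2"
    using dvd_add[OF b12] by (fastforce simp: algebra_simps)
  have "P dvd b1 * d2 - b2 * d3 + d2 * b3" using b1 d3 z by simp
  hence "P dvd d1 * b2"
    using dvd_diff[OF _ b1223(1)] by (fastforce simp: algebra_simps)
  hence d1: "P dvd d1" using b2 cancel by blast
  have "P dvd d1 * c2 + c2 * d3 - c1 * d2" using c1 c2 by simp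
  hence "P dvd d2 * c3"
    using dvd_add[OF b1223(2)] by (fastforce simp: algebra_simps)
  hence d2: "P dvd d2" using c3 cancel by blast
  show "P dvd a1 - 1 \<and> P dvd b1 \<and> P dvd c1 \<and> P dvd d1"
    and "P dvd a2 \<and> P dvd b2 - 1 \<and> P dvd c2 \<and> P dvd d2"
    and "P dvd c3 - 1 \<and> P dvd d3"
    and "P dvd c4 \<and> P dvd d4 - 1"
    using a1 b1 c1 d1 a2 b2' c2 d2 c3' d3 c4 d4' by blast+
qed

section \<open>Lattices and the bracket\<close>

text \<open>
  Elements of \<open>L\<close> are represented by integer vectors, that is, by the coordinates with respect to
  \<open>x1, x2, x3, x4\<close>. Working with representatives in \<open>\<int>\<^sup>4\<close> makes the bracket strictly additive, and
  congruences modulo four different powers of \<open>p\<close> become membership in one subgroup.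
\<close>
type_synonym vec = "int \<times> int \<times> int \<times> int"

fun scale :: "int \<Rightarrow> vec \<Rightarrow> vec" where
  "scale k (a, b, c, d) = (k * a, k * b, k * c, k * d)"

lemma scale_minus_left: "scale (- k) u = - scale k u"
  by (cases u) simp
lemma scale_add_left: "scale (j + k) u = scale j u + scale k u"
  by (cases u) (simp add: algebra_simps)
lemma scale_diff_right: "scale k (u - v) = scale k u - scale k v"
  by (cases u; cases v) (simp add: algebra_simps)
lemma scale_scale: "scale j (scale k u) = scale (j * k) u"
  by (cases u) (simp add: algebra_simps)
lemma scale_zero_right [simp]: "scale k 0 = 0"
  by (simp add: zero_prod_def)
lemma scale_one [simp]: "scale 1 u = u" and scale_zero [simp]: "scale 0 u = 0"
  by (cases u; simp add: zero_prod_def)+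

locale rigid_p_group =
  fixes p n :: nat
  assumes prime_p: "Factorial_Ring.prime p" and odd_p: "odd p" and n_ge_3: "3 \<le> n"
begin

definition P :: int where "P = int p"
text \<open>
  With this factor the moduli are \<open>p\<^sup>n = P\<^sup>3 R\<close>, \<open>P\<^sup>3\<close>, \<open>P\<^sup>2\<close>, \<open>P\<^sup>2\<close>. For \<open>n = 3\<close> it is \<open>1\<close>, so
  arguments that avoid the divisibility of \<open>R\<close> by \<open>P\<close> treat all \<open>n\<close> alike.
\<close>
definition R :: int where "R = P ^ (n - 3)"

lemma prime_P: "Factorial_Ring.prime P" using prime_p by (simp add: P_def)
lemma P_pos: "0 < P" and R_pos: "0 < R"
  using prime_P by (auto simp: R_def prime_gt_0_int)
lemma coprime_P_2: "coprime P 2" using odd_p by (simp add: P_def)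
lemma P_pow_n: "P ^ n = P ^ 3 * R"
  using n_ge_3 by (simp add: R_def flip: power_add)

text \<open>
  The vectors that represent \<open>0\<close> in \<open>L\<close>.
\<close>
definition Kernel :: "vec set" where
  "Kernel = {(a, b, c, d). P ^ 3 * R dvd a \<and> P ^ 3 dvd b \<and> P ^ 2 dvd c \<and> P ^ 2 dvd d}"

text \<open>
  The vectors that represent elements of \<open>pL\<close>, which is the center as well as the Frattini subgroup
  of the group.
\<close>
definition Frattini :: "vec set" where
  "Frattini = {(a, b, c, d). P dvd a \<and> P dvd b \<and> P dvd c \<and> P dvd d}"

text \<open>
  Twice this bracket is the commutator. The coordinates are multiples of \<open>w1, w2, w3, w4\<close> by
  the entries of the bracket table.
\<close>
fun bracket :: "vec \<Rightarrow> vec \<Rightarrow> vec" where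
  "bracket (a, b, c, d) (a', b', c', d') =
     (P ^ 2 * R * (c * d' - d * c'),
      P ^ 2 * (b * d' - d * b'),
      P * (a * c' - c * a'),
      P * (a * b' - b * a' + b * c' - c * b'))"

lemma Kernel_mem: "(a, b, c, d) \<in> Kernel \<longleftrightarrow>
    P ^ 3 * R dvd a \<and> P ^ 3 dvd b \<and> P ^ 2 dvd c \<and> P ^ 2 dvd d"
  by (simp add: Kernel_def)
lemma Frattini_mem: "(a, b, c, d) \<in> Frattini \<longleftrightarrow> P dvd a \<and> P dvd b \<and> P dvd c \<and> P dvd d"
  by (simp add: Frattini_def)

lemma Kernel_0 [simp]: "0 \<in> Kernel" by (simp add: Kernel_def zero_prod_def)
lemma Kernel_add: "u \<in> Kernel \<Longrightarrow> v \<in> Kernel \<Longrightarrow> u + v \<in> Kernel"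
  by (auto simp: Kernel_def)
lemma Kernel_minus: "u \<in> Kernel \<Longrightarrow> - u \<in> Kernel" by (auto simp: Kernel_def)
lemma Kernel_diff: "u \<in> Kernel \<Longrightarrow> v \<in> Kernel \<Longrightarrow> u - v \<in> Kernel"
  by (auto simp: Kernel_def)
lemma Kernel_scale_2: "scale 2 u \<in> Kernel \<longleftrightarrow> u \<in> Kernel"
  using coprime_P_2
  by (cases u) (simp add: Kernel_mem R_def coprime_dvd_mult_right_iff flip: power_add)

lemma Frattini_0 [simp]: "0 \<in> Frattini" by (simp add: Frattini_def zero_prod_def)
lemma Frattini_add: "u \<in> Frattini \<Longrightarrow> v \<in> Frattini \<Longrightarrow> u + v \<in> Frattini"
  by (auto simp: Frattini_def)
lemma Frattini_diff: "u \<in> Frattini \<Longrightarrow> v \<in> Frattini \<Longrightarrow> u - v \<in> Frattini"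
  by (auto simp: Frattini_def)
lemma Frattini_scale_P: "scale P u \<in> Frattini" by (cases u) (simp add: Frattini_mem)
lemma Frattini_ex: "u \<in> Frattini \<Longrightarrow> \<exists>v. u = scale P v"
proof (cases u)
  case (fields a b c d)
  assume "u \<in> Frattini"
  then obtain a' b' c' d' where "a = P * a'" "b = P * b'" "c = P * c'" "d = P * d'"
    by (auto simp: fields Frattini_mem elim!: dvdE)
  hence "u = scale P (a', b', c', d')" by (simp add: fields)
  thus ?thesis by blast
qed
lemma Kernel_Frattini: "u \<in> Kernel \<Longrightarrow> u \<in> Frattini"
proof (cases u)
  case (fields a b c d)
  assume "u \<in> Kernel"
  moreover have "P dvd P ^ 3 * R" "P dvd P ^ 3" "P dvd P ^ 2" by auto
  ultimately show ?thesis using fields by (auto simp: Kernel_mem Frattini_mem intro: dvd_trans)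
qed

lemma bracket_add_left: "bracket (u + v) w = bracket u w + bracket v w"
  by (cases u; cases v; cases w) (simp add: algebra_simps)
lemma bracket_add_right: "bracket w (u + v) = bracket w u + bracket w v"
  by (cases u; cases v; cases w) (simp add: algebra_simps)
lemma bracket_diff_left: "bracket (u - v) w = bracket u w - bracket v w"
  by (cases u; cases v; cases w) (simp add: algebra_simps)
lemma bracket_diff_right: "bracket w (u - v) = bracket w u - bracket w v"
  by (cases u; cases v; cases w) (simp add: algebra_simps)
lemma bracket_scale_left: "bracket (scale k u) v = scale k (bracket u v)"
  by (cases u; cases v) (simp add: algebra_simps)
lemma bracket_self: "bracket u u = 0" by (cases u) (simp add: zero_prod_def)
lemma bracket_swap: "bracket v u = - bracket u v" by (cases u; cases v) (simp add: algebra_simps)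
lemma bracket_zero_left [simp]: "bracket 0 u = 0" and bracket_zero_right [simp]: "bracket u 0 = 0"
  by (cases u; simp add: zero_prod_def)+

lemma bracket_Frattini: "bracket u v \<in> Frattini"
  by (cases u; cases v) (simp add: Frattini_mem power2_eq_square)
lemma P_bracket_Kernel: "scale P (bracket u v) \<in> Kernel"
  by (cases u; cases v) (simp add: Kernel_mem power2_eq_square power3_eq_cube)
lemma bracket_Frattini_left: "u \<in> Frattini \<Longrightarrow> bracket u v \<in> Kernel"
  using Frattini_ex P_bracket_Kernel bracket_scale_left by metis
lemma bracket_Frattini_right: "v \<in> Frattini \<Longrightarrow> bracket u v \<in> Kernel"
  using bracket_Frattini_left bracket_swap Kernel_minus by metis

section \<open>The group\<close>

text \<open>
  A canonical representative of each class modulo \<open>Kernel\<close>; it is encoded as a natural number to obtain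
  the group on the required type.
\<close>
fun reduce :: "vec \<Rightarrow> vec" where
  "reduce (a, b, c, d) = (a mod (P ^ 3 * R), b mod P ^ 3, c mod P ^ 2, d mod P ^ 2)"

definition el :: "vec \<Rightarrow> nat" where "el u = to_nat (reduce u)"
definition rep :: "nat \<Rightarrow> vec" where "rep x = from_nat x"

definition G :: "nat monoid" where
  "G = \<lparr>carrier = range el, monoid.mult = \<lambda>x y. el (rep x + rep y + bracket (rep x) (rep y)), one = el 0\<rparr>"

lemma el_eq_iff: "el u = el v \<longleftrightarrow> u - v \<in> Kernel"
  by (cases u; cases v) (simp add: el_def Kernel_mem mod_eq_dvd_iff)

lemma rep_el: "rep (el u) - u \<in> Kernel"
  by (cases u) (auto simp: el_def rep_def Kernel_mem simp flip: mod_eq_dvd_iff)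

lemma carrier_G: "carrier G = range el" by (simp add: G_def)
lemma el_closed [simp]: "el u \<in> carrier G" by (simp add: carrier_G)
lemma one_G: "\<one>\<^bsub>G\<^esub> = el 0" by (simp add: G_def)

lemma carrier_G_cases: "x \<in> carrier G \<Longrightarrow> \<exists>u. x = el u" by (auto simp: carrier_G)

lemma mult_el: "el u \<otimes>\<^bsub>G\<^esub> el v = el (u + v + bracket u v)"
proof -
  let ?u = "rep (el u)" and ?v = "rep (el v)"
  have u: "?u - u \<in> Kernel" and v: "?v - v \<in> Kernel" by (rule rep_el)+
  have "bracket (?u - u) ?v \<in> Kernel" "bracket u (?v - v) \<in> Kernel"
    using u v by (simp_all add: Kernel_Frattini bracket_Frattini_left bracket_Frattini_right)
  hence "(?u - u) + (?v - v) + (bracket (?u - u) ?v + bracket u (?v - v)) \<in> Kernel"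
    using u v by (intro Kernel_add)
  moreover have "(?u - u) + (?v - v) + (bracket (?u - u) ?v + bracket u (?v - v))
      = (?u + ?v + bracket ?u ?v) - (u + v + bracket u v)"
    by (simp add: bracket_diff_left bracket_diff_right)
  ultimately show ?thesis by (simp add: G_def el_eq_iff)
qed

lemma group_G: "group G"
proof (rule groupI)
  fix x y z assume "x \<in> carrier G" "y \<in> carrier G" "z \<in> carrier G"
  then obtain u v w where "x = el u" "y = el v" "z = el w" by (auto simp: carrier_G)
  moreover have "bracket (bracket u v) w - bracket u (bracket v w) \<in> Kernel"
    by (intro Kernel_diff bracket_Frattini_left bracket_Frattini_right bracket_Frattini)
  ultimately show "x \<otimes>\<^bsub>G\<^esub> y \<otimes>\<^bsub>G\<^esub> z = x \<otimes>\<^bsub>G\<^esub> (y \<otimes>\<^bsub>G\<^esub> z)"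
    by (simp add: mult_el el_eq_iff bracket_add_left bracket_add_right algebra_simps)
next
  fix x assume "x \<in> carrier G"
  then obtain u where u: "x = el u" by (auto simp: carrier_G)
  have "bracket (- u) u = 0" using bracket_diff_left[of 0 u u] by (simp add: bracket_self)
  hence "el (- u) \<otimes>\<^bsub>G\<^esub> x = \<one>\<^bsub>G\<^esub>" by (simp add: u one_G mult_el)
  thus "\<exists>y\<in>carrier G. y \<otimes>\<^bsub>G\<^esub> x = \<one>\<^bsub>G\<^esub>" by (meson el_closed)
next
  fix x assume "x \<in> carrier G"
  thus "\<one>\<^bsub>G\<^esub> \<otimes>\<^bsub>G\<^esub> x = x" by (auto simp: carrier_G one_G mult_el)
qed (auto simp: carrier_G one_G mult_el)

sublocale group G by (rule group_G)

lemma inv_el: "inv\<^bsub>G\<^esub> (el u) = el (- u)"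
proof (rule inv_equality)
  have "bracket (- u) u = 0" using bracket_diff_left[of 0 u u] by (simp add: bracket_self)
  thus "el (- u) \<otimes>\<^bsub>G\<^esub> el u = \<one>\<^bsub>G\<^esub>" by (simp add: one_G mult_el)
qed auto

text \<open>
  Powers are multiples because the bracket is alternating; a one-sided cocycle with the same
  commutators would add binomial terms.
\<close>
lemma pow_el: "el u [^]\<^bsub>G\<^esub> (k::nat) = el (scale (int k) u)"
  by (induction k) (simp_all add: one_G mult_el bracket_scale_left bracket_self scale_add_left add.commute)

lemma order_G: "order G = p ^ (n + 7)"
proof -
  let ?B = "{0..<P ^ 3 * R} \<times> {0..<P ^ 3} \<times> {0..<P ^ 2} \<times> {0..<P ^ 2}"
  have pos: "0 < P ^ 3 * R" "0 < P ^ 3" "0 < P ^ 2" using P_pos R_pos by auto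
  have "range reduce = ?B"
  proof
    show "range reduce \<subseteq> ?B" using pos by auto
    show "?B \<subseteq> range reduce"
    proof
      fix u assume "u \<in> ?B"
      hence "reduce u = u" by auto
      thus "u \<in> range reduce" by (metis rangeI)
    qed
  qed
  moreover have "carrier G = to_nat ` range reduce"
    unfolding carrier_G el_def[abs_def] by (simp only: image_image)
  ultimately have "carrier G = to_nat ` ?B" by simp
  hence "order G = card ?B" by (simp add: order_def card_image)
  also have "\<dots> = nat (P ^ n) * (nat (P ^ 3) * (nat (P ^ 2) * nat (P ^ 2)))"
    by (simp add: card_cartesian_product P_pow_n)
  also have "\<dots> = p ^ n * (p ^ 3 * (p ^ 2 * p ^ 2))" by (simp add: P_def flip: of_nat_power)
  also have "\<dots> = p ^ (n + 7)" by (simp flip: power_add)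
  finally show ?thesis .
qed

lemma pow_exponent: "x \<in> carrier G \<Longrightarrow> x [^]\<^bsub>G\<^esub> (p ^ n) = \<one>\<^bsub>G\<^esub>"
proof -
  assume "x \<in> carrier G"
  then obtain a b c d where "x = el (a, b, c, d)" by (auto simp: carrier_G)
  moreover have "P ^ 3 dvd P ^ n" "P ^ 2 dvd P ^ n"
    using n_ge_3 by (auto intro: le_imp_power_dvd)
  ultimately show ?thesis
    by (simp add: pow_el one_G el_eq_iff Kernel_mem P_pow_n flip: P_def)
qed

lemma exponent_G: "group_exponent G = p ^ n"
  unfolding group_exponent_def
proof (rule Least_equality)
  show "0 < p ^ n \<and> (\<forall>x\<in>carrier G. x [^]\<^bsub>G\<^esub> (p ^ n) = \<one>\<^bsub>G\<^esub>)"
    using pow_exponent prime_p by (simp add: prime_gt_0_nat)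
next
  fix e :: nat assume e: "0 < e \<and> (\<forall>x\<in>carrier G. x [^]\<^bsub>G\<^esub> e = \<one>\<^bsub>G\<^esub>)"
  hence "el (1, 0, 0, 0) [^]\<^bsub>G\<^esub> e = \<one>\<^bsub>G\<^esub>" by simp
  hence "P ^ 3 * R dvd int e" by (simp add: pow_el one_G el_eq_iff Kernel_mem)
  hence "P ^ n dvd int e" by (simp add: P_pow_n)
  hence "int (p ^ n) dvd int e" by (simp add: P_def)
  hence "p ^ n dvd e" by (simp only: int_dvd_int_iff)
  thus "p ^ n \<le> e" using e by (simp add: dvd_imp_le)
qed

text \<open>
  This needs \<open>p\<close> odd: the two products differ by twice the bracket.
\<close>
lemma commute_iff: "el u \<otimes>\<^bsub>G\<^esub> el v = el v \<otimes>\<^bsub>G\<^esub> el u \<longleftrightarrow> bracket u v \<in> Kernel"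
proof -
  have "u + v + bracket u v - (v + u + bracket v u) = scale 2 (bracket u v)"
    using scale_add_left[of 1 1] by (simp add: bracket_swap[of v u] algebra_simps)
  thus ?thesis by (simp add: mult_el el_eq_iff Kernel_scale_2)
qed

text \<open>
  Bracketing with \<open>x3\<close> detects the first and the last coordinate modulo \<open>p\<close>, bracketing with \<open>x4\<close> the
  second and the third.
\<close>
lemma center_iff: "el u \<in> group_center G \<longleftrightarrow> u \<in> Frattini"
proof
  assume "u \<in> Frattini"
  thus "el u \<in> group_center G"
    by (auto simp: group_center_def carrier_G commute_iff bracket_Frattini_left)
next
  assume u: "el u \<in> group_center G"
  hence Kernel: "bracket u v \<in> Kernel" for v
    using el_closed[of v] commute_iff[of u v] unfolding group_center_def by blast
  obtain a b c d where abcd: "u = (a, b, c, d)" by (cases u)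
  have "P \<noteq> 0" "R \<noteq> 0" using P_pos R_pos by auto
  thus "u \<in> Frattini"
    using Kernel[of "(0, 0, 1, 0)"] Kernel[of "(0, 0, 0, 1)"]
    by (simp add: abcd Kernel_mem Frattini_mem power2_eq_square power3_eq_cube mult.assoc)
qed

lemma no_abelian_factor: "no_nontrivial_abelian_direct_factor G"
proof (rule no_abelian_direct_factor_if_center_p_powers)
  fix z assume z: "z \<in> group_center G"
  then obtain u where u: "z = el u" by (auto simp: group_center_def carrier_G)
  then obtain v where "u = scale P v" using z center_iff Frattini_ex by blast
  hence "z = el v [^]\<^bsub>G\<^esub> p" by (simp add: u pow_el P_def)
  thus "\<exists>t\<in>carrier G. z = t [^]\<^bsub>G\<^esub> p" by (metis el_closed)
qed (rule pow_exponent)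

section \<open>Every automorphism is central\<close>

text \<open>
  A bracket relation \<open>[u,v] = p s w\<close> is thus a statement about products and powers in the group. The
  factor \<open>p\<close> makes the value \<open>p s w\<close> central.
\<close>
lemma commutator_iff:
  "el u \<otimes>\<^bsub>G\<^esub> el v = el v \<otimes>\<^bsub>G\<^esub> el u \<otimes>\<^bsub>G\<^esub> el (scale (2 * P * s) w) \<longleftrightarrow>
     bracket u v - scale (P * s) w \<in> Kernel"
proof -
  let ?w = "scale (2 * P * s) w"
  have "?w \<in> Frattini" using Frattini_scale_P[of "scale (2 * s) w"] by (simp add: scale_scale ac_simps)
  hence L: "bracket x ?w \<in> Kernel" for x by (rule bracket_Frattini_right)
  have "?w = scale 2 (scale (P * s) w)" by (simp add: scale_scale ac_simps)
  hence "u + v + bracket u v - (v + u + bracket v u + ?w) = scale 2 (bracket u v - scale (P * s) w)"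
    using scale_add_left[of 1 1] by (simp add: bracket_swap[of v u] scale_diff_right algebra_simps)
  hence "u + v + bracket u v - (v + u + bracket v u + ?w + bracket (v + u + bracket v u) ?w)
      = scale 2 (bracket u v - scale (P * s) w) - bracket (v + u + bracket v u) ?w"
    by (simp add: algebra_simps)
  moreover have "x - bracket (v + u + bracket v u) ?w \<in> Kernel \<longleftrightarrow> x \<in> Kernel" for x
    using L Kernel_add Kernel_diff by (metis diff_add_cancel)
  ultimately show ?thesis by (simp only: mult_el el_eq_iff Kernel_scale_2)
qed

text \<open>
  A homomorphism of the group preserves each bracket relation of the form \<open>[u,v] = p s w\<close>, to
  which all the defining ones belong. This replaces the full Baer correspondence.
\<close>
lemma hom_bracket:
  assumes hom: "\<phi> \<in> hom G G"
    and im: "\<phi> (el u) = el u'" "\<phi> (el v) = el v'" "\<phi> (el w) = el w'"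
    and br: "bracket u v - scale (P * int s) w \<in> Kernel"
  shows "bracket u' v' - scale (P * int s) w' \<in> Kernel"
proof -
  have pow: "el (scale (2 * P * int s) x) = el x [^]\<^bsub>G\<^esub> (2 * p * s)" for x
    by (simp add: pow_el P_def)
  interpret group_hom G G \<phi> using hom by unfold_locales
  have "\<phi> (el u \<otimes>\<^bsub>G\<^esub> el v) = \<phi> (el v \<otimes>\<^bsub>G\<^esub> el u \<otimes>\<^bsub>G\<^esub> el w [^]\<^bsub>G\<^esub> (2 * p * s))"
    using br commutator_iff pow by metis
  hence "el u' \<otimes>\<^bsub>G\<^esub> el v' = el v' \<otimes>\<^bsub>G\<^esub> el u' \<otimes>\<^bsub>G\<^esub> el w' [^]\<^bsub>G\<^esub> (2 * p * s)"
    using im by (simp add: hom_nat_pow)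
  thus ?thesis using commutator_iff pow by metis
qed

text \<open>
  Each hypothesis consists of four congruences, one for each coordinate, modulo different powers of
  \<open>p\<close>. Those that concern only the matrix modulo \<open>p\<close> are divided by the common power of
  \<open>p\<close>. The first two coordinates of \<open>b12\<close> and \<open>b23\<close> involve the unknown \<open>y4\<close> to a precision beyond
  \<open>p\<close>, so only their difference, in which \<open>y4\<close> cancels, is used.
\<close>
lemma images_congruent:
  assumes nz: "y3 \<notin> Frattini" "y4 \<notin> Frattini"
    and ord: "scale (P ^ 2) y3 \<in> Kernel" "scale (P ^ 2) y4 \<in> Kernel"
    and b12: "bracket y1 y2 - scale P y4 \<in> Kernel" and b13: "bracket y1 y3 - scale P y3 \<in> Kernel"
    and b14: "bracket y1 y4 \<in> Kernel" and b23: "bracket y2 y3 - scale P y4 \<in> Kernel"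
    and b24: "bracket y2 y4 - scale (P ^ 2) y2 \<in> Kernel"
    and b34: "bracket y3 y4 - scale (P ^ 2 * R) y1 \<in> Kernel"
  shows "y1 - (1, 0, 0, 0) \<in> Frattini" "y2 - (0, 1, 0, 0) \<in> Frattini"
    "y3 - (0, 0, 1, 0) \<in> Frattini" "y4 - (0, 0, 0, 1) \<in> Frattini"
proof -
  obtain a1 b1 c1 d1 where y1: "y1 = (a1, b1, c1, d1)" by (cases y1)
  obtain a2 b2 c2 d2 where y2: "y2 = (a2, b2, c2, d2)" by (cases y2)
  obtain a3 b3 c3 d3 where y3: "y3 = (a3, b3, c3, d3)" by (cases y3)
  obtain a4 b4 c4 d4 where y4: "y4 = (a4, b4, c4, d4)" by (cases y4)
  note y = y1 y2 y3 y4
  have nz0: "P \<noteq> 0" "R \<noteq> 0" using P_pos R_pos by auto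
  have canc1: "P dvd x" if "P ^ 3 * R dvd P ^ 2 * R * x" for x
    using that nz0 by (auto simp: power2_eq_square power3_eq_cube)
  have canc2: "P dvd x" if "P ^ 3 dvd P ^ 2 * x" for x
    using that nz0 by (auto simp: power2_eq_square power3_eq_cube)
  have canc3: "P dvd x" if "P ^ 2 dvd P * x" for x
    using that nz0 by (auto simp: power2_eq_square)
  have ord': "P dvd a \<and> P dvd b" if "scale (P ^ 2) (a, b, c, d) \<in> Kernel" for a b c d
  proof -
    have *: "P ^ 3 * R dvd P ^ 2 * a" "P ^ 3 dvd P ^ 2 * b" using that by (simp_all add: Kernel_mem)
    have "P ^ 3 dvd P ^ 2 * a" using *(1) by (rule dvd_mult_left)
    thus ?thesis using *(2) canc2 by blast
  qed
  have z: "P dvd a3" "P dvd b3" "P dvd a4" "P dvd b4" using ord ord' y by blast+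
  have nz': "\<not> (P dvd c3 \<and> P dvd d3)" "\<not> (P dvd c4 \<and> P dvd d4)"
    using nz z by (simp_all add: y Frattini_mem)
  have e34: "P dvd c3 * d4 - d3 * c4 - a1"
    by (rule canc1) (use b34 in \<open>simp add: Kernel_mem y right_diff_distrib\<close>)
  have e23: "P dvd a2 * c3 - c2 * a3 - c4" "P dvd a2 * b3 - b2 * a3 + b2 * c3 - c2 * b3 - d4"
    by (rule canc3; use b23 in \<open>simp add: Kernel_mem y algebra_simps\<close>)+
  have e13: "P dvd a1 * c3 - c1 * a3 - c3" "P dvd a1 * b3 - b1 * a3 + b1 * c3 - c1 * b3 - d3"
    by (rule canc3; use b13 in \<open>simp add: Kernel_mem y algebra_simps\<close>)+
  have e14: "P dvd c1 * d4 - d1 * c4" "P dvd b1 * d4 - d1 * b4" "P dvd a1 * c4 - c1 * a4"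
    using b14 by (auto simp: Kernel_mem y intro: canc1 canc2 canc3)
  have e24: "P dvd b2 * d4 - d2 * b4 - b2"
    by (rule canc2) (use b24 in \<open>simp add: Kernel_mem y right_diff_distrib\<close>)
  have e12: "P dvd a1 * c2 - c1 * a2 - c4"
    by (rule canc3) (use b12 in \<open>simp add: Kernel_mem y right_diff_distrib\<close>)
  have "bracket y1 y2 - bracket y2 y3 \<in> Kernel" using Kernel_diff[OF b12 b23] by simp
  hence e1223: "P dvd (b1 * d2 - d1 * b2) - (b2 * d3 - d2 * b3)" "P dvd (c1 * d2 - d1 * c2) - (c2 * d3 - d2 * c3)"
    by (auto simp: Kernel_mem y right_diff_distrib[symmetric] intro: canc1 canc2)
  note r = mod_p_rigidity[OF prime_P nz' z e34 e23 e13 e14 e24 e12 e1223]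
  show "y1 - (1, 0, 0, 0) \<in> Frattini" "y2 - (0, 1, 0, 0) \<in> Frattini"
    "y3 - (0, 0, 1, 0) \<in> Frattini" "y4 - (0, 0, 0, 1) \<in> Frattini"
    using r z by (simp_all add: y Frattini_mem)
qed

text \<open>
  A homomorphism and the identity induce homomorphisms into the elementary abelian group \<open>L/pL\<close>; they
  agree if they agree on generators. As \<open>\<phi>\<close> is defined on classes only, the property is shown to be
  closed under the operations of \<open>\<int>\<^sup>4\<close>.
\<close>
lemma hom_congruent:
  assumes hom: "\<phi> \<in> hom G G"
    and gens: "\<And>e. e \<in> {(1, 0, 0, 0), (0, 1, 0, 0), (0, 0, 1, 0), (0, 0, 0, 1)} \<Longrightarrow>
      \<exists>y. \<phi> (el e) = el y \<and> y - e \<in> Frattini"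
  shows "\<exists>y. \<phi> (el u) = el y \<and> y - u \<in> Frattini"
proof -
  interpret h: group_hom G G \<phi> using hom by unfold_locales
  define good where "good u \<longleftrightarrow> (\<exists>y. \<phi> (el u) = el y \<and> y - u \<in> Frattini)" for u
  have cong: "good v" if u: "good u" and uv: "u - v \<in> Kernel" for u v
  proof -
    obtain y where y: "\<phi> (el u) = el y" "y - u \<in> Frattini" using u unfolding good_def by blast
    have "el u = el v" using uv by (simp add: el_eq_iff)
    moreover have "(y - u) + (u - v) \<in> Frattini" using Frattini_add[OF y(2) Kernel_Frattini[OF uv]] .
    ultimately show ?thesis using y by (auto simp: good_def)
  qed
  have mult: "good (u + v + bracket u v)" if uv: "good u" "good v" for u v
  proof -
    obtain y y' where y: "\<phi> (el u) = el y" "y - u \<in> Frattini" "\<phi> (el v) = el y'" "y' - v \<in> Frattini"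
      using uv unfolding good_def by blast
    have "\<phi> (el u \<otimes>\<^bsub>G\<^esub> el v) = el y \<otimes>\<^bsub>G\<^esub> el y'" using y by simp
    hence "\<phi> (el (u + v + bracket u v)) = el (y + y' + bracket y y')" by (simp add: mult_el)
    moreover have "(y - u) + (y' - v) + (bracket y y' - bracket u v) \<in> Frattini"
      by (rule Frattini_add[OF Frattini_add[OF y(2,4)] Frattini_diff[OF bracket_Frattini bracket_Frattini]])
    hence "y + y' + bracket y y' - (u + v + bracket u v) \<in> Frattini" by (simp add: algebra_simps)
    ultimately show ?thesis by (auto simp: good_def)
  qed
  \<comment> \<open>An element of \<open>pL\<close> is a \<open>p\<close>-th power, hence so is its image.\<close>
  have fra: "good z" if z: "z \<in> Frattini" for z
  proof -
    obtain t where t: "z = scale P t" using Frattini_ex z by blast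
    obtain s where s: "\<phi> (el t) = el s" using carrier_G_cases[OF h.hom_closed[OF el_closed]] by blast
    have "\<phi> (el t [^]\<^bsub>G\<^esub> p) = el s [^]\<^bsub>G\<^esub> p" using s by (simp add: h.hom_nat_pow)
    hence "\<phi> (el z) = el (scale P s)" by (simp add: pow_el t P_def)
    moreover have "scale P s - z \<in> Frattini" using z by (intro Frattini_diff Frattini_scale_P)
    ultimately show ?thesis by (auto simp: good_def)
  qed
  \<comment> \<open>A sum is the product corrected by a bracket, which is an element of \<open>pL\<close>.\<close>
  have add: "good (u + v)" if "good u" "good v" for u v
  proof (rule cong)
    let ?w = "u + v + bracket u v" and ?z = "- bracket u v"
    have z: "?z \<in> Frattini" using Frattini_diff[OF Frattini_0 bracket_Frattini] by simp
    show "good (?w + ?z + bracket ?w ?z)" using mult that fra z by blast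
    show "?w + ?z + bracket ?w ?z - (u + v) \<in> Kernel" using bracket_Frattini_right[OF z] by simp
  qed
  have minus: "good (- u)" if u: "good u" for u
  proof -
    obtain y where y: "\<phi> (el u) = el y" "y - u \<in> Frattini" using u unfolding good_def by blast
    have "\<phi> (inv\<^bsub>G\<^esub> (el u)) = inv\<^bsub>G\<^esub> (el y)" using y by (simp add: h.hom_inv)
    hence "\<phi> (el (- u)) = el (- y)" by (simp add: inv_el)
    moreover have "- y - (- u) \<in> Frattini" using Frattini_diff[OF Frattini_0 y(2)] by simp
    ultimately show ?thesis unfolding good_def by blast
  qed
  have nat: "good (scale (int k) u)" if "good u" for k u
    by (induction k) (simp_all add: fra add that scale_add_left)
  have int: "good (scale k u)" if u: "good u" for k u
  proof (cases k)
    case (nonneg j)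
    thus ?thesis using nat[OF u, of j] by simp
  next
    case (neg j)
    thus ?thesis using minus[OF nat[OF u, of "Suc j"]] by (simp only: scale_minus_left)
  qed
  obtain a b c d where u: "u = (a, b, c, d)" by (cases u)
  have "good (scale a (1, 0, 0, 0) + scale b (0, 1, 0, 0) + scale c (0, 0, 1, 0) + scale d (0, 0, 0, 1))"
    by (intro add int) (auto simp: good_def intro!: gens)
  thus ?thesis by (simp add: u good_def)
qed

lemma auto_central:
  assumes "\<phi> \<in> auto G"
  shows "\<phi> \<in> autcent G"
proof -
  have hom: "\<phi> \<in> hom G G" and inj: "inj_on \<phi> (carrier G)"
    using assms by (auto simp: auto_def Bij_def bij_betw_def)
  interpret h: group_hom G G \<phi> using hom by unfold_locales
  have "\<exists>y. \<phi> (el u) = el y" for u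
    using carrier_G_cases[OF h.hom_closed[OF el_closed]] .
  then obtain y1 y2 y3 y4 where y: "\<phi> (el (1, 0, 0, 0)) = el y1" "\<phi> (el (0, 1, 0, 0)) = el y2"
    "\<phi> (el (0, 0, 1, 0)) = el y3" "\<phi> (el (0, 0, 0, 1)) = el y4" by metis
  \<comment> \<open>The generators \<open>x3\<close> and \<open>x4\<close> do not commute, so by injectivity their images do not
    either and cannot be central.\<close>
  have e34: "bracket (0, 0, 1, 0) (0, 0, 0, 1) \<notin> Kernel"
    using P_pos R_pos prime_P by (auto simp: Kernel_mem power2_eq_square power3_eq_cube mult.assoc)
  have "el (0, 0, 1, 0) \<otimes>\<^bsub>G\<^esub> el (0, 0, 0, 1) \<noteq> el (0, 0, 0, 1) \<otimes>\<^bsub>G\<^esub> el (0, 0, 1, 0)"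
    using e34 by (simp only: commute_iff not_False_eq_True)
  hence "\<phi> (el (0, 0, 1, 0) \<otimes>\<^bsub>G\<^esub> el (0, 0, 0, 1)) \<noteq> \<phi> (el (0, 0, 0, 1) \<otimes>\<^bsub>G\<^esub> el (0, 0, 1, 0))"
    using inj by (simp only: inj_on_eq_iff m_closed el_closed not_False_eq_True)
  hence nc: "bracket y3 y4 \<notin> Kernel" using y by (simp add: commute_iff)
  have pow: "scale (P ^ 2) w' \<in> Kernel"
    if im: "\<phi> (el w) = el w'" and w: "scale (P ^ 2) w \<in> Kernel" for w w'
  proof -
    have "el w [^]\<^bsub>G\<^esub> (p ^ 2) = \<one>\<^bsub>G\<^esub>"
      using w by (simp add: pow_el one_G el_eq_iff flip: P_def)
    hence "\<phi> (el w [^]\<^bsub>G\<^esub> (p ^ 2)) = \<one>\<^bsub>G\<^esub>" by simp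
    hence "el w' [^]\<^bsub>G\<^esub> (p ^ 2) = \<one>\<^bsub>G\<^esub>" using im by (simp add: h.hom_nat_pow)
    thus ?thesis by (simp add: pow_el one_G el_eq_iff flip: P_def)
  qed
  \<comment> \<open>The multiples of the generators that occur as values in the bracket table.\<close>
  have s: "P * int (p * p ^ (n - 3)) = P ^ 2 * R" "P * int p = P ^ 2" "P * int 1 = P" "P * int 0 = 0"
    by (simp_all add: P_def R_def power2_eq_square)
  note hb = hom_bracket[OF hom]
  have "bracket y1 y2 - scale P y4 \<in> Kernel"
    using hb[OF y(1,2,4), of 1] unfolding s by (simp add: Kernel_mem)
  moreover have "bracket y1 y3 - scale P y3 \<in> Kernel"
    using hb[OF y(1,3,3), of 1] unfolding s by (simp add: Kernel_mem)
  moreover have "bracket y1 y4 \<in> Kernel"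
    using hb[OF y(1,4,1), of 0] unfolding s by (simp add: Kernel_mem)
  moreover have "bracket y2 y3 - scale P y4 \<in> Kernel"
    using hb[OF y(2,3,4), of 1] unfolding s by (simp add: Kernel_mem)
  moreover have "bracket y2 y4 - scale (P ^ 2) y2 \<in> Kernel"
    using hb[OF y(2,4,2), of p] unfolding s by (simp add: Kernel_mem)
  moreover have "bracket y3 y4 - scale (P ^ 2 * R) y1 \<in> Kernel"
    using hb[OF y(3,4,1), of "p * p ^ (n - 3)"] unfolding s by (simp add: Kernel_mem)
  moreover have "y3 \<notin> Frattini" "y4 \<notin> Frattini" using nc bracket_Frattini_left bracket_Frattini_right by blast+
  moreover have "scale (P ^ 2) y3 \<in> Kernel" by (rule pow[OF y(3)]) (simp add: Kernel_mem)
  moreover have "scale (P ^ 2) y4 \<in> Kernel" by (rule pow[OF y(4)]) (simp add: Kernel_mem)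
  ultimately have ic: "y1 - (1, 0, 0, 0) \<in> Frattini" "y2 - (0, 1, 0, 0) \<in> Frattini"
    "y3 - (0, 0, 1, 0) \<in> Frattini" "y4 - (0, 0, 0, 1) \<in> Frattini"
    by (metis images_congruent)+
  have all: "\<exists>y. \<phi> (el u) = el y \<and> y - u \<in> Frattini" for u
    by (rule hom_congruent[OF hom]) (use y ic in auto)
  have "inv\<^bsub>G\<^esub> x \<otimes>\<^bsub>G\<^esub> \<phi> x \<in> group_center G" if x: "x \<in> carrier G" for x
  proof -
    obtain u where u: "x = el u" using carrier_G_cases[OF x] by blast
    obtain y where y: "\<phi> (el u) = el y" "y - u \<in> Frattini" using all by blast
    have "y - u + bracket (- u) y \<in> Frattini" using Frattini_add[OF y(2) bracket_Frattini] .
    thus ?thesis by (simp add: u y inv_el mult_el center_iff)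
  qed
  thus ?thesis using assms by (auto simp: autcent_def)
qed

section \<open>Two automorphisms that do not commute\<close>

text \<open>
  The map \<open>1 + f\<close> on the group, restricted to the carrier because automorphisms are extensional.
\<close>
definition shift :: "(vec \<Rightarrow> vec) \<Rightarrow> nat \<Rightarrow> nat" where
  "shift f = restrict (\<lambda>x. el (rep x + f (rep x))) (carrier G)"

text \<open>
  The conditions make \<open>f\<close> an endomorphism of \<open>L\<close> that maps into the center, kills the
  brackets and has square zero.
\<close>
definition central_nilpotent :: "(vec \<Rightarrow> vec) \<Rightarrow> bool" where
  "central_nilpotent f \<longleftrightarrow>
     (\<forall>u v. f (u - v) = f u - f v) \<and> f ` Kernel \<subseteq> Kernel \<and>
     (\<forall>u. f u \<in> Frattini) \<and> (\<forall>u v. f (bracket u v) \<in> Kernel) \<and> (\<forall>u. f (f u) \<in> Kernel)"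

text \<open>
  Since \<open>f\<close> is central and kills brackets, both \<open>[u + f u, v + f v]\<close> and \<open>[u,v] + f [u,v]\<close> equal
  \<open>[u,v]\<close>. Square zero makes \<open>1 - f\<close> the inverse of \<open>1 + f\<close>.
\<close>
lemma shift_auto:
  assumes "central_nilpotent f"
  shows shift_el: "shift f (el u) = el (u + f u)" and "shift f \<in> auto G"
proof -
  have diff: "f (u - v) = f u - f v" and lam: "u \<in> Kernel \<Longrightarrow> f u \<in> Kernel"
    and fra: "f u \<in> Frattini" and brk: "f (bracket u v) \<in> Kernel" and nil: "f (f u) \<in> Kernel" for u v
    using assms by (auto simp: central_nilpotent_def)
  have add: "f (u + v) = f u + f v" for u v
    using diff[of "u + v" v] by (simp add: algebra_simps)
  have el: "shift f (el u) = el (u + f u)" for u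
  proof -
    have "(rep (el u) - u) + f (rep (el u) - u) \<in> Kernel" by (intro Kernel_add lam rep_el)
    thus ?thesis by (simp add: shift_def el_eq_iff diff algebra_simps)
  qed
  show "shift f (el u) = el (u + f u)" by (rule el)
  have "shift f \<in> hom G G"
  proof (rule homI)
    fix x assume "x \<in> carrier G"
    thus "shift f x \<in> carrier G" by (auto simp: carrier_G el)
  next
    fix x y assume "x \<in> carrier G" "y \<in> carrier G"
    then obtain u v where uv: "x = el u" "y = el v" by (auto simp: carrier_G)
    have "f (bracket u v) - (bracket u (f v) + bracket (f u) v + bracket (f u) (f v)) \<in> Kernel"
      by (intro Kernel_diff Kernel_add brk bracket_Frattini_left bracket_Frattini_right fra)
    moreover have "f (bracket u v) - (bracket u (f v) + bracket (f u) v + bracket (f u) (f v))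
        = (u + v + bracket u v + f (u + v + bracket u v)) - (u + f u + (v + f v) + bracket (u + f u) (v + f v))"
      by (simp add: add bracket_add_left bracket_add_right)
    ultimately show "shift f (x \<otimes>\<^bsub>G\<^esub> y) = shift f x \<otimes>\<^bsub>G\<^esub> shift f y"
      by (simp add: uv mult_el el el_eq_iff)
  qed
  moreover have "inj_on (shift f) (carrier G)"
  proof (rule inj_onI)
    fix x y assume "x \<in> carrier G" "y \<in> carrier G" and eq: "shift f x = shift f y"
    then obtain u v where uv: "x = el u" "y = el v" by (auto simp: carrier_G)
    let ?w = "u - v"
    have w: "?w + f ?w \<in> Kernel" using eq by (simp add: uv el el_eq_iff diff algebra_simps)
    have "f ?w + f (f ?w) \<in> Kernel" using lam[OF w] by (simp only: add)
    hence "f ?w \<in> Kernel" using Kernel_diff[OF _ nil[of ?w], of "f ?w + f (f ?w)"] by simp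
    hence "?w \<in> Kernel" using Kernel_diff[OF w, of "f ?w"] by simp
    thus "x = y" by (simp add: uv el_eq_iff)
  qed
  moreover have "shift f ` carrier G = carrier G"
  proof
    show "shift f ` carrier G \<subseteq> carrier G" by (auto simp: carrier_G el)
    show "carrier G \<subseteq> shift f ` carrier G"
    proof
      fix x assume "x \<in> carrier G"
      then obtain u where u: "x = el u" by (auto simp: carrier_G)
      have "u - (u - f u + f (u - f u)) \<in> Kernel" using nil by (simp add: diff)
      hence "x = shift f (el (u - f u))" by (simp only: u el el_eq_iff)
      thus "x \<in> shift f ` carrier G" by (rule image_eqI) simp
    qed
  qed
  moreover have "shift f \<in> extensional (carrier G)" by (simp add: shift_def)
  ultimately show "shift f \<in> auto G" by (simp add: auto_def Bij_def bij_betw_def)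
qed

text \<open>
  The coefficient \<open>P R = p\<^bsup>n-2\<^esup>\<close> in \<open>raise\<close> is chosen so that composing the two maps multiplies by
  \<open>P\<^sup>2 R = p\<^bsup>n-1\<^esup>\<close>, the largest power of \<open>p\<close> that does not annihilate \<open>x1\<close>.
\<close>
fun lower :: "vec \<Rightarrow> vec" where "lower (a, b, c, d) = (0, P * a, 0, 0)"
fun raise :: "vec \<Rightarrow> vec" where "raise (a, b, c, d) = (P * R * b, 0, 0, 0)"

lemma lower: "central_nilpotent lower"
proof -
  have d: "lower (u - v) = lower u - lower v" for u v
    by (cases u; cases v) (simp add: algebra_simps zero_prod_def)
  have 2: "lower u \<in> Kernel" if "u \<in> Kernel" for u
    using that by (cases u) (auto simp: Kernel_mem dest: dvd_mult_left)
  have 3: "lower u \<in> Frattini" "lower (lower u) \<in> Kernel" for u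
    by (cases u; simp add: Kernel_mem Frattini_mem)+
  have 4: "lower (bracket u v) \<in> Kernel" for u v
    by (cases u; cases v) (simp add: Kernel_mem power3_eq_cube power2_eq_square)
  show ?thesis using d 2 3 4 by (auto simp: central_nilpotent_def)
qed

lemma raise: "central_nilpotent raise"
proof -
  have d: "raise (u - v) = raise u - raise v" for u v
    by (cases u; cases v) (simp add: algebra_simps zero_prod_def)
  have 2: "raise u \<in> Kernel" if "u \<in> Kernel" for u
    using that by (cases u) (auto simp: Kernel_mem elim!: dvdE)
  have 3: "raise u \<in> Frattini" "raise (raise u) \<in> Kernel" for u
    by (cases u; simp add: Kernel_mem Frattini_mem)+
  have 4: "raise (bracket u v) \<in> Kernel" for u v
    by (cases u; cases v) (simp add: Kernel_mem power3_eq_cube power2_eq_square)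
  show ?thesis using d 2 3 4 by (auto simp: central_nilpotent_def)
qed

text \<open>
  The two composites differ by \<open>w1\<close> on the first generator.
\<close>
lemma Aut_not_abelian: "\<not> comm_group (AutoGroup G)"
proof
  assume "comm_group (AutoGroup G)"
  then interpret A: comm_group "AutoGroup G" .
  let ?f = "shift lower" and ?g = "shift raise" and ?x = "el (1, 0, 0, 0)"
  have fg: "?f \<in> auto G" "?g \<in> auto G" using shift_auto(2) lower raise by blast+
  hence Bij: "?f \<in> Bij (carrier G)" "?g \<in> Bij (carrier G)" by (auto simp: auto_def)
  have "?f \<otimes>\<^bsub>AutoGroup G\<^esub> ?g = ?g \<otimes>\<^bsub>AutoGroup G\<^esub> ?f"
    using A.m_comm fg by (simp add: AutoGroup_def)
  hence "compose (carrier G) ?f ?g = compose (carrier G) ?g ?f"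
    using Bij by (simp add: AutoGroup_def BijGroup_def)
  hence "?f (?g ?x) = ?g (?f ?x)" by (metis compose_eq el_closed)
  hence "P ^ 3 * R dvd - (P ^ 2 * R)"
    by (simp add: shift_el[OF lower] shift_el[OF raise] el_eq_iff zero_prod_def Kernel_mem
        power2_eq_square algebra_simps)
  thus False using P_pos R_pos prime_P by (auto simp: power2_eq_square power3_eq_cube mult.assoc)
qed

end

theorem theoremB:
  fixes p n m :: nat
  assumes "Factorial_Ring.prime p" and "odd p" and "n \<ge> 3" and "m = n + 7"
  shows "\<exists>G :: nat monoid.
    group G \<and>
    order G = p ^ m \<and>
    group_exponent G = p ^ n \<and>
    no_nontrivial_abelian_direct_factor G \<and>
    AutoGroup G = AutcentGroup G \<and>
    \<not> comm_group (AutoGroup G)"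
proof -
  interpret rigid_p_group p n using assms by unfold_locales
  have "autcent G = auto G" using auto_central by (auto simp: autcent_def)
  hence "AutoGroup G = AutcentGroup G" by (simp add: AutcentGroup_def AutoGroup_def)
  thus ?thesis
    using group_G order_G exponent_G no_abelian_factor Aut_not_abelian assms(4) by blast
qed

end
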